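(* Let $V$ be a finite set and let $\mathcal{L}\subseteq\mathcal{T}(V)$ be a semigraphoid. Then $\mathcal{L}$ is closed under the reverse pseudographoid rule if and only if it is closed under composition.
   Context: For a finite set $V$, $\mathcal{T}(V)$ is the set of all triples $(A,B|C)$ with $A,B,C\subseteq V$ pairwise disjoint and $A,B$ nonempty ($C$ may be empty). A relation is a subset of $\mathcal{T}(V)$. Juxtaposition denotes union ($BC=B\cup C$), and lowercase letters denote elements of $V$ identified with singletons. A relation $\mathcal{L}$ is a semigraphoid if for all pairwise disjoint $A,B,C,S\subseteq V$ with $A,B,C$ nonempty it is closed under: symmetry, $(A,B|S)\in\mathcal{L}\iff(B,A|S)\in\mathcal{L}$; decomposition, $(A,BC|S)\in\mathcal{L}\Rightarrow(A,B|S)\in\mathcal{L}$; weak union, $(A,BC|S)\in\mathcal{L}\Rightarrow(A,B|SC)\in\mathcal{L}$; contraction, $(A,B|S),(A,C|BS)\in\mathcal{L}\Rightarrow(A,BC|S)\in\mathcal{L}$. Closed under the reverse pseudographoid rule: for all distinct $a,b,c\in V$ and $S\subseteq V\setminus\{a,b,c\}$, $(a,b|S),(a,c|S)\in\mathcal{L}$ implies $(a,b|Sc),(a,c|Sb)\in\mathcal{L}$. Closed under composition: for all pairwise disjoint $A,B,C,S\subseteq V$ with $A,B,C$ nonempty, $(A,B|S),(A,C|S)\in\mathcal{L}$ implies $(A,BC|S)\in\mathcal{L}$.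
   Formalization: Symmetry is required of every triple (A,B|S), as in the usual definition of a semigraphoid, and not only of those leaving room for a further nonempty C disjoint from A, B, S, as the joint quantification literally says; with the literal version the claim fails for a four-element V. *)

theory Defs
  imports Main
begin

text \<open>A statement \<open>(A, B | C)\<close> is encoded as the tuple \<open>(A, B, C)\<close>; the third component is the
  conditioning set, the only one that may be empty.\<close>

definition triples :: "'a set \<Rightarrow> ('a set \<times> 'a set \<times> 'a set) set" where
  "triples V = {(A, B, C). A \<subseteq> V \<and> B \<subseteq> V \<and> C \<subseteq> V \<and> A \<noteq> {} \<and> B \<noteq> {} \<and>
     A \<inter> B = {} \<and> A \<inter> C = {} \<and> B \<inter> C = {}}"

text \<open>The sets \<open>A, B, C, S\<close> over which contraction, decomposition, weak union and composition are
  quantified.  This is written out because \<open>disjoint {A, B, C, S}\<close> would also allow equal sets.\<close>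

definition admissible :: "'a set \<Rightarrow> 'a set \<Rightarrow> 'a set \<Rightarrow> 'a set \<Rightarrow> 'a set \<Rightarrow> bool" where
  "admissible V A B C S \<longleftrightarrow>
     A \<subseteq> V \<and> B \<subseteq> V \<and> C \<subseteq> V \<and> S \<subseteq> V \<and> A \<noteq> {} \<and> B \<noteq> {} \<and> C \<noteq> {} \<and>
     A \<inter> B = {} \<and> A \<inter> C = {} \<and> A \<inter> S = {} \<and> B \<inter> C = {} \<and> B \<inter> S = {} \<and> C \<inter> S = {}"

text \<open>Symmetry mentions only \<open>A, B, S\<close>, so it is required of every triple, including those with
  \<open>A \<union> B \<union> S = V\<close>, which leave no room for a nonempty \<open>C\<close>.\<close>

definition semigraphoid :: "'a set \<Rightarrow> ('a set \<times> 'a set \<times> 'a set) set \<Rightarrow> bool" where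
  "semigraphoid V L \<longleftrightarrow>
     L \<subseteq> triples V \<and>
     (\<forall>A B S. (A, B, S) \<in> triples V \<longrightarrow> ((A, B, S) \<in> L \<longleftrightarrow> (B, A, S) \<in> L)) \<and>
     (\<forall>A B C S. admissible V A B C S \<longrightarrow> (A, B \<union> C, S) \<in> L \<longrightarrow> (A, B, S) \<in> L) \<and>
     (\<forall>A B C S. admissible V A B C S \<longrightarrow> (A, B \<union> C, S) \<in> L \<longrightarrow> (A, B, S \<union> C) \<in> L) \<and>
     (\<forall>A B C S. admissible V A B C S \<longrightarrow>
        (A, B, S) \<in> L \<longrightarrow> (A, C, B \<union> S) \<in> L \<longrightarrow> (A, B \<union> C, S) \<in> L)"

definition reverse_pseudographoid_closed ::
  "'a set \<Rightarrow> ('a set \<times> 'a set \<times> 'a set) set \<Rightarrow> bool" where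
  "reverse_pseudographoid_closed V L \<longleftrightarrow>
     (\<forall>a\<in>V. \<forall>b\<in>V. \<forall>c\<in>V. \<forall>S. a \<noteq> b \<longrightarrow> a \<noteq> c \<longrightarrow> b \<noteq> c \<longrightarrow> S \<subseteq> V - {a, b, c} \<longrightarrow>
        ({a}, {b}, S) \<in> L \<longrightarrow> ({a}, {c}, S) \<in> L \<longrightarrow>
        ({a}, {b}, S \<union> {c}) \<in> L \<and> ({a}, {c}, S \<union> {b}) \<in> L)"

definition composition_closed :: "'a set \<Rightarrow> ('a set \<times> 'a set \<times> 'a set) set \<Rightarrow> bool" where
  "composition_closed V L \<longleftrightarrow>
     (\<forall>A B C S. admissible V A B C S \<longrightarrow>
        (A, B, S) \<in> L \<longrightarrow> (A, C, S) \<in> L \<longrightarrow> (A, B \<union> C, S) \<in> L)"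

end

theory Submission
  imports Defs
begin

text \<open>Composition followed by weak union gives the reverse pseudographoid rule at once.

  For the converse, the rule together with contraction is composition on singletons: from
  \<open>(a, b | S)\<close> and \<open>(a, c | S)\<close> it yields \<open>(a, c | Sb)\<close>, which contracts with \<open>(a, b | S)\<close> to
  \<open>(a, bc | S)\<close>.  Singletons are then enlarged one side at a time, and each enlargement uses the
  same device: to add an element \<open>b\<close> to \<open>B\<close>, move \<open>B\<close> into the conditioning set by weak union,
  compose \<open>b\<close> with \<open>C\<close> there, and bring \<open>B\<close> back by contraction (\<open>composition_extend\<close>).  This
  treats \<open>B\<close>, then \<open>C\<close> because composition is symmetric in the two
  (\<open>singleton_left_composition\<close>).  Finally \<open>A\<close> is split in the same way, with weak union and
  contraction transferred to the left component by symmetry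
  (\<open>composition_if_reverse_pseudographoid\<close>).  The conditioning set grows along the way, so the
  singleton case is needed for every \<open>S\<close>, which is what the rule provides.  Finiteness of \<open>V\<close> makes
  these inductions on \<open>A\<close>, \<open>B\<close> and \<open>C\<close> possible.\<close>

lemma semigraphoid_triples:
  assumes "semigraphoid V L" "(A, B, S) \<in> L"
  shows "(A, B, S) \<in> triples V"
  using assms unfolding semigraphoid_def by blast

lemma symmetry:
  assumes "semigraphoid V L" "(A, B, S) \<in> L"
  shows "(B, A, S) \<in> L"
  using assms semigraphoid_triples[OF assms] unfolding semigraphoid_def by blast

text \<open>Members of \<open>L\<close> are triples of \<open>V\<close>, and this leaves only the splitting of the second component
  to be checked when an axiom is applied.\<close>

lemma admissible_union:
  assumes "semigraphoid V L" "(A, B \<union> C, S) \<in> L" "B \<noteq> {}" "C \<noteq> {}" "B \<inter> C = {}"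
  shows "admissible V A B C S"
  using semigraphoid_triples[OF assms(1,2)] assms(3-)
  unfolding triples_def admissible_def by blast

lemma decomposition:
  assumes "semigraphoid V L" "(A, B \<union> C, S) \<in> L" "B \<noteq> {}" "C \<noteq> {}" "B \<inter> C = {}"
  shows "(A, B, S) \<in> L"
  using admissible_union[OF assms] assms(1,2) unfolding semigraphoid_def by blast

lemma weak_union:
  assumes "semigraphoid V L" "(A, B \<union> C, S) \<in> L" "B \<noteq> {}" "C \<noteq> {}" "B \<inter> C = {}"
  shows "(A, B, S \<union> C) \<in> L"
  using admissible_union[OF assms] assms(1,2) unfolding semigraphoid_def by blast

lemma contraction:
  assumes "semigraphoid V L" "(A, B, S) \<in> L" "(A, C, S \<union> B) \<in> L"
  shows "(A, B \<union> C, S) \<in> L"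
proof -
  have "admissible V A B C S"
    using semigraphoid_triples[OF assms(1,2)] semigraphoid_triples[OF assms(1,3)]
    by (simp add: triples_def admissible_def Int_Un_distrib Int_commute)
  moreover have "(A, C, B \<union> S) \<in> L"
    using assms(3) by (simp add: Un_commute)
  moreover have "\<forall>A B C S. admissible V A B C S \<longrightarrow>
      (A, B, S) \<in> L \<longrightarrow> (A, C, B \<union> S) \<in> L \<longrightarrow> (A, B \<union> C, S) \<in> L"
    using assms(1) unfolding semigraphoid_def by (elim conjE)
  ultimately show ?thesis
    using assms(2) by blast
qed

lemma left_decomposition:
  assumes "semigraphoid V L" "(A \<union> D, B, S) \<in> L" "A \<noteq> {}" "D \<noteq> {}" "A \<inter> D = {}"
  shows "(A, B, S) \<in> L"
  using symmetry[OF assms(1) decomposition[OF assms(1) symmetry[OF assms(1,2)] assms(3-)]] .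

lemma left_weak_union:
  assumes "semigraphoid V L" "(A \<union> D, B, S) \<in> L" "A \<noteq> {}" "D \<noteq> {}" "A \<inter> D = {}"
  shows "(A, B, S \<union> D) \<in> L"
  using symmetry[OF assms(1) weak_union[OF assms(1) symmetry[OF assms(1,2)] assms(3-)]] .

lemma left_contraction:
  assumes "semigraphoid V L" "(A, B, S) \<in> L" "(D, B, S \<union> A) \<in> L"
  shows "(A \<union> D, B, S) \<in> L"
  using symmetry[OF assms(1) contraction[OF assms(1) symmetry[OF assms(1,2)] symmetry[OF assms(1,3)]]] .

lemma singleton_composition:
  assumes "semigraphoid V L" "reverse_pseudographoid_closed V L"
    and "({a}, {b}, S) \<in> L" "({a}, {c}, S) \<in> L" "b \<noteq> c"
  shows "({a}, {b} \<union> {c}, S) \<in> L"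
proof -
  have "a \<in> V" "b \<in> V" "c \<in> V" "a \<noteq> b" "a \<noteq> c" "S \<subseteq> V - {a, b, c}"
    using semigraphoid_triples[OF assms(1,3)] semigraphoid_triples[OF assms(1,4)]
    unfolding triples_def by auto
  then have "({a}, {c}, S \<union> {b}) \<in> L"
    using assms(2-) unfolding reverse_pseudographoid_closed_def by blast
  with assms(1,3) show ?thesis
    by (rule contraction)
qed

text \<open>When \<open>b\<close> joins \<open>B\<close>, composition must be applied over \<open>S \<union> B\<close>, so the hypothesis ranges over all
  conditioning sets.  There \<open>(A, b | SB)\<close> is weak union of the given triple, whereas
  \<open>(A, C | SB)\<close> is weak union of the induction hypothesis \<open>(A, BC | S)\<close>.\<close>

lemma composition_extend:
  assumes sg: "semigraphoid V L"
    and single: "\<And>b S. (A, {b}, S) \<in> L \<Longrightarrow> (A, C, S) \<in> L \<Longrightarrow> b \<notin> C \<Longrightarrow> (A, {b} \<union> C, S) \<in> L"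
    and "finite B" "B \<noteq> {}" "B \<inter> C = {}" "(A, B, S) \<in> L" "(A, C, S) \<in> L"
  shows "(A, B \<union> C, S) \<in> L"
  using assms(3-)
proof (induction B rule: finite_ne_induct)
  case (singleton b)
  then show ?case using single by blast
next
  case (insert b B)
  have C: "C \<noteq> {}"
    using semigraphoid_triples[OF sg insert.prems(3)] unfolding triples_def by blast
  have bB: "(A, {b} \<union> B, S) \<in> L" "(A, B \<union> {b}, S) \<in> L"
    using insert.prems(2) by simp_all
  have B: "(A, B, S) \<in> L"
    using decomposition[OF sg bB(2)] insert.hyps by blast
  have "(A, C \<union> B, S) \<in> L"
    using insert.IH[OF _ B insert.prems(3)] insert.prems(1) by (simp add: Un_commute)
  then have "(A, C, S \<union> B) \<in> L"
    using weak_union[OF sg] C insert.hyps insert.prems(1) by blast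
  moreover have "(A, {b}, S \<union> B) \<in> L"
    using weak_union[OF sg bB(1)] insert.hyps by blast
  ultimately have "(A, {b} \<union> C, S \<union> B) \<in> L"
    using single insert.prems(1) by blast
  then have "(A, B \<union> ({b} \<union> C), S) \<in> L"
    by (rule contraction[OF sg B])
  then show ?case by simp
qed

text \<open>Enlarging \<open>C\<close> from a singleton is the same step as enlarging \<open>B\<close> with the two exchanged: for
  a fixed \<open>b\<close> it gives composition of \<open>b\<close> with all of \<open>C\<close>, over every conditioning set, which is the
  hypothesis for enlarging \<open>B\<close>.\<close>

lemma singleton_left_composition:
  assumes sg: "semigraphoid V L" and rpg: "reverse_pseudographoid_closed V L"
    and "finite B" "finite C" "B \<inter> C = {}" "({a}, B, S) \<in> L" "({a}, C, S) \<in> L"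
  shows "({a}, B \<union> C, S) \<in> L"
proof -
  have ne: "B \<noteq> {}" "C \<noteq> {}"
    using semigraphoid_triples[OF sg assms(6)] semigraphoid_triples[OF sg assms(7)]
    unfolding triples_def by blast+
  have "({a}, {b} \<union> C, T) \<in> L" if "({a}, {b}, T) \<in> L" "({a}, C, T) \<in> L" "b \<notin> C" for b T
  proof -
    have "({a}, C \<union> {b}, T) \<in> L"
    proof (rule composition_extend[OF sg])
      show "({a}, {c} \<union> {b}, S') \<in> L"
        if "({a}, {c}, S') \<in> L" "({a}, {b}, S') \<in> L" "c \<notin> {b}" for c S'
        using singleton_composition[OF sg rpg] that by blast
    qed (use that ne assms(4) in auto)
    then show ?thesis by (simp add: Un_commute)
  qed
  then show ?thesis
    using composition_extend[OF sg _ assms(3) ne(1) assms(5-)] by blast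
qed

text \<open>Each \<open>(Aa, X | S)\<close> with \<open>X = B\<close> or \<open>X = C\<close> splits into \<open>(A, X | S)\<close> and \<open>(a, X | SA)\<close>, and
  contraction on the left reverses the splitting.  Hence composition can be done separately on the
  two parts.\<close>

lemma composition_if_reverse_pseudographoid:
  assumes sg: "semigraphoid V L" and rpg: "reverse_pseudographoid_closed V L"
    and "finite A" "A \<noteq> {}" and fin: "finite B" "finite C" and disj: "B \<inter> C = {}"
    and "(A, B, S) \<in> L" "(A, C, S) \<in> L"
  shows "(A, B \<union> C, S) \<in> L"
  using assms(3,4,8,9)
proof (induction A rule: finite_ne_induct)
  case (singleton a)
  then show ?case
    using singleton_left_composition[OF sg rpg fin disj] by blast
next
  case (insert a A)
  have part: "(A, X, S) \<in> L" "({a}, X, S \<union> A) \<in> L" if "(insert a A, X, S) \<in> L" for X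
    using left_decomposition[OF sg, of A "{a}" X S] left_weak_union[OF sg, of "{a}" A X S]
      insert.hyps that by auto
  have "(A, B \<union> C, S) \<in> L"
    using insert.IH part(1) insert.prems by blast
  moreover have "({a}, B \<union> C, S \<union> A) \<in> L"
    using singleton_left_composition[OF sg rpg fin disj] part(2) insert.prems by blast
  ultimately have "(A \<union> {a}, B \<union> C, S) \<in> L"
    by (rule left_contraction[OF sg])
  then show ?case by simp
qed

theorem lemma5p3:
  fixes V :: "'a set" and L :: "('a set \<times> 'a set \<times> 'a set) set"
  assumes "finite V"
    and "L \<subseteq> triples V"
    and "semigraphoid V L"
  shows "reverse_pseudographoid_closed V L \<longleftrightarrow> composition_closed V L"
proof
  assume rpg: "reverse_pseudographoid_closed V L"
  show "composition_closed V L"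
    unfolding composition_closed_def
  proof (intro allI impI)
    fix A B C S
    assume adm: "admissible V A B C S" and L: "(A, B, S) \<in> L" "(A, C, S) \<in> L"
    have "finite A" "finite B" "finite C" "A \<noteq> {}" "B \<inter> C = {}"
      using adm \<open>finite V\<close> unfolding admissible_def by (auto intro: finite_subset)
    then show "(A, B \<union> C, S) \<in> L"
      using composition_if_reverse_pseudographoid[OF assms(3) rpg] L by blast
  qed
next
  assume comp: "composition_closed V L"
  have weak: "({a}, {b}, S \<union> {c}) \<in> L"
    if "b \<noteq> c" "({a}, {b}, S) \<in> L" "({a}, {c}, S) \<in> L" for a b c S
  proof -
    have "admissible V {a} {b} {c} S"
      using that semigraphoid_triples[OF assms(3) that(2)] semigraphoid_triples[OF assms(3) that(3)]
      by (simp add: triples_def admissible_def)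
    then have "({a}, {b} \<union> {c}, S) \<in> L"
      using comp that unfolding composition_closed_def by blast
    then show ?thesis
      using weak_union[OF assms(3)] that(1) by blast
  qed
  show "reverse_pseudographoid_closed V L"
    unfolding reverse_pseudographoid_closed_def
  proof (intro ballI allI impI)
    fix a b c S
    assume "b \<noteq> c" "({a}, {b}, S) \<in> L" "({a}, {c}, S) \<in> L"
    then show "({a}, {b}, S \<union> {c}) \<in> L \<and> ({a}, {c}, S \<union> {b}) \<in> L"
      using weak[of b c] weak[of c b] by blast
  qed
qed

end
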